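(* Let row sums $\mathcal{R} = (r_1, r_2, \ldots, r_m)$ and column sums $\mathcal{C} = (c_1, c_2, \ldots, c_n)$ be given, where $r_1 \geq r_2 \geq \cdots \geq r_m$ and $c_1 \geq c_2 \geq \cdots \geq c_n$. Assume that the line sums $(\mathcal{R},\mathcal{C})$ are consistent but do not uniquely determine a set. Let $\alpha = \alpha(\mathcal{R},\mathcal{C})$. Then there exist finite sets $F_2, F_3 \subset \mathbb{Z}^2$, both with line sums $(\mathcal{R},\mathcal{C})$, such that \[ |F_2 \bigtriangleup F_3| \geq 2\alpha + 2 . \] This bound is sharp: for each integer $\alpha \geq 1$ there are non-increasing sequences $\mathcal{R}$ and $\mathcal{C}$ such that the line sums $(\mathcal{R},\mathcal{C})$ are consistent, do not uniquely determine a set, satisfy $\alpha(\mathcal{R},\mathcal{C}) = \alpha$, and are such that for any $F_2$ and $F_3$ with line sums $(\mathcal{R},\mathcal{C})$ we have $|F_2 \bigtriangleup F_3| \leq 2\alpha + 2$.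
   Context: For $i \in \mathbb{Z}$, row $i$ is the set $\{(x,y) \in \mathbb{Z}^2 : x = i\}$; for $j \in \mathbb{Z}$, column $j$ is the set $\{(x,y) \in \mathbb{Z}^2 : y = j\}$. For a finite set $F \subset \mathbb{Z}^2$, the row sum of row $i$ is the number of elements of $F$ in row $i$, and the column sum of column $j$ is the number of elements of $F$ in column $j$. Let $\mathcal{R} = (r_1, \ldots, r_m)$ and $\mathcal{C} = (c_1, \ldots, c_n)$ be finite sequences of non-negative integers. A finite set $F \subset \mathbb{Z}^2$ has line sums $(\mathcal{R},\mathcal{C})$ (equivalently, has row sums $\mathcal{R}$ and column sums $\mathcal{C}$) if row $i$ of $F$ has sum $r_i$ for $1 \leq i \leq m$, column $j$ of $F$ has sum $c_j$ for $1 \leq j \leq n$, and all other row and column sums of $F$ are zero (so $F \subseteq \{1,\ldots,m\} \times \{1,\ldots,n\}$). The line sums $(\mathcal{R},\mathcal{C})$ are consistent if there exists a set $F$ with line sums $(\mathcal{R},\mathcal{C})$. They uniquely determine a set if there is exactly one set $F$ with line sums $(\mathcal{R},\mathcal{C})$; thus "consistent but do not uniquely determine a set" means that at least two different sets with these line sums exist. For non-increasing $\mathcal{R}$ and $\mathcal{C}$, put $v_j = \#\{l : 1 \leq l \leq m,\ r_l \geq j\}$ for $1 \leq j \leq n$, and define \[ \alpha(\mathcal{R},\mathcal{C}) = \frac{1}{2} \sum_{j=1}^{n} |c_j - v_j| , \] which is an integer when $(\mathcal{R},\mathcal{C})$ is consistent. $A \bigtriangleup B$ denotes the symmetric difference of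 the sets $A$ and $B$, and $|A|$ the number of elements of $A$. *)

theory Defs
  imports Complex_Main
begin

definition row :: "int \<Rightarrow> (int \<times> int) set" where
  "row i = {(x, y). x = i}"

definition column :: "int \<Rightarrow> (int \<times> int) set" where
  "column j = {(x, y). y = j}"

definition row_sum :: "(int \<times> int) set \<Rightarrow> int \<Rightarrow> nat" where
  "row_sum F i = card (F \<inter> row i)"

definition column_sum :: "(int \<times> int) set \<Rightarrow> int \<Rightarrow> nat" where
  "column_sum F j = card (F \<inter> column j)"

text \<open>
  Sequences indexed from 1 are represented by lists: \<open>r\<^sub>i\<close> is \<open>R ! (i - 1)\<close>.
  Finiteness of \<open>F\<close> must be stated explicitly, because \<open>card\<close> is 0 on infinite sets.
\<close>

definition has_line_sums :: "nat list \<Rightarrow> nat list \<Rightarrow> (int \<times> int) set \<Rightarrow> bool" where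
  "has_line_sums R C F \<longleftrightarrow>
     finite F \<and>
     (\<forall>i\<in>{1..length R}. row_sum F (int i) = R ! (i - 1)) \<and>
     (\<forall>j\<in>{1..length C}. column_sum F (int j) = C ! (j - 1)) \<and>
     (\<forall>i. i \<notin> {1..int (length R)} \<longrightarrow> row_sum F i = 0) \<and>
     (\<forall>j. j \<notin> {1..int (length C)} \<longrightarrow> column_sum F j = 0)"

definition consistent :: "nat list \<Rightarrow> nat list \<Rightarrow> bool" where
  "consistent R C \<longleftrightarrow> (\<exists>F. has_line_sums R C F)"

definition uniquely_determine :: "nat list \<Rightarrow> nat list \<Rightarrow> bool" where
  "uniquely_determine R C \<longleftrightarrow> (\<exists>!F. has_line_sums R C F)"

definition non_increasing :: "nat list \<Rightarrow> bool" where
  "non_increasing xs \<longleftrightarrow> sorted_wrt (\<ge>) xs"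

definition v_seq :: "nat list \<Rightarrow> nat \<Rightarrow> nat" where
  "v_seq R j = card {l \<in> {1..length R}. R ! (l - 1) \<ge> j}"

definition alpha :: "nat list \<Rightarrow> nat list \<Rightarrow> real" where
  "alpha R C = 1 / 2 * (\<Sum>j = 1..length C. \<bar>real (C ! (j - 1)) - real (v_seq R j)\<bar>)"

end

theory Submission
  imports Defs
begin

text \<open>
  Two sets with the given line sums add up to a matrix with entries in \<open>{0, 1, 2}\<close> and doubled line
  sums; conversely any such matrix \<open>y\<close> splits into two sets, whose symmetric difference is the set
  of cells with entry 1. So take \<open>y\<close> with the maximal number \<open>s\<close> of ones. If a row of \<open>y\<close> had a 0 to
  the left of a 2, an exchange between two columns would create more ones. Let \<open>f\<close> be the
  left-justified 0-1 matrix with row sums \<open>R\<close>. Then each row of \<open>y - 2 f\<close> has either no entries from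
  zeros of \<open>y\<close> inside \<open>f\<close> or none from twos outside \<open>f\<close>, so the absolute values of its entries add up
  to at most twice the number of ones of \<open>y\<close> in that row. Summing these over columns first gives
  \<open>4 \<alpha> \<le> 2 s\<close>. Equality is impossible: one more exchange, in a row containing a 1, yields another
  maximal matrix with strict inequality in that row. As \<open>2 \<alpha>\<close> and \<open>s\<close> are even, \<open>s \<ge> 2 \<alpha> + 2\<close>.
  Permutation matrices show sharpness.
\<close>

section \<open>Balanced splitting\<close>

text \<open>A nonempty fibre of even size has a second element besides any given one. Deleting two
  elements of one fibre keeps all fibres even, so induction pairs the rest.\<close>

lemma pairing_within_fibres:
  assumes "finite E" and "\<And>b. even (card {x \<in> E. h x = b})"
  shows "\<exists>s. \<forall>x\<in>E. s x \<in> E \<and> s x \<noteq> x \<and> s (s x) = x \<and> h (s x) = h x"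
  using assms
proof (induction E rule: finite_psubset_induct)
  case (psubset E)
  show ?case
  proof (cases "E = {}")
    case False
    then obtain x where x: "x \<in> E" by blast
    have fin: "finite {z \<in> E. h z = h x}" using psubset.hyps by simp
    have "\<exists>z\<in>E. h z = h x \<and> z \<noteq> x"
    proof (rule ccontr)
      assume "\<not> ?thesis"
      then have "{z \<in> E. h z = h x} = {x}" using x by blast
      then show False using psubset.prems[of "h x"] by simp
    qed
    then obtain z where z: "z \<in> E" "h z = h x" "z \<noteq> x" by blast
    let ?E = "E - {x, z}"
    have "even (card {w \<in> ?E. h w = b})" for b
    proof (cases "b = h x")
      case True
      have "{w \<in> ?E. h w = b} = {w \<in> E. h w = h x} - {x, z}" using True by blast
      moreover have "{x, z} \<subseteq> {w \<in> E. h w = h x}" using x z by auto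
      ultimately have "card {w \<in> ?E. h w = b} = card {w \<in> E. h w = h x} - 2"
        using z by (simp add: card_Diff_subset)
      then show ?thesis using psubset.prems[of "h x"] by simp
    next
      case False
      then have "{w \<in> ?E. h w = b} = {w \<in> E. h w = b}" using z by auto
      then show ?thesis using psubset.prems[of b] by simp
    qed
    moreover have "?E \<subset> E" using x by blast
    ultimately obtain s where
      s: "\<forall>w\<in>?E. s w \<in> ?E \<and> s w \<noteq> w \<and> s (s w) = w \<and> h (s w) = h w"
      using psubset.IH[of ?E] by blast
    show ?thesis
      by (rule exI[of _ "s(x := z, z := x)"]) (use s x z in auto)
  qed simp
qed

text \<open>Joining \<open>x\<close> to \<open>s x\<close> and to \<open>t x\<close> superposes two
  perfect matchings. The components are double edges or even cycles, hence 2-colourable. The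
  induction deletes one \<open>s\<close>-pair at a time instead of tracing cycles; \<open>t\<close>
  is arbitrary because it gets rewired around the deleted pair.\<close>

lemma alternating_colouring:
  assumes "finite E"
    and "\<forall>x\<in>E. s x \<in> E \<and> s x \<noteq> x \<and> s (s x) = x"
    and "\<forall>x\<in>E. t x \<in> E \<and> t x \<noteq> x \<and> t (t x) = x"
  shows "\<exists>f :: 'a \<Rightarrow> bool. \<forall>x\<in>E. f (s x) \<noteq> f x \<and> f (t x) \<noteq> f x"
  using assms
proof (induction E arbitrary: t rule: finite_psubset_induct)
  case (psubset E)
  show ?case
  proof (cases "E = {}")
    case False
    then obtain x where x: "x \<in> E" by blast
    define a where "a = s x"
    have a: "a \<in> E" "a \<noteq> x" "s a = x" using bspec[OF psubset.prems(1) x] by (auto simp: a_def)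
    let ?E = "E - {x, a}"
    have sub: "?E \<subset> E" using x by blast
    have s': "\<forall>w\<in>?E. s w \<in> ?E \<and> s w \<noteq> w \<and> s (s w) = w"
    proof
      fix w assume "w \<in> ?E"
      then show "s w \<in> ?E \<and> s w \<noteq> w \<and> s (s w) = w"
        using bspec[OF psubset.prems(1), of w] a by (auto simp: a_def)
    qed
    show ?thesis
    proof (cases "t x = a")
      \<comment> \<open>Here \<open>x\<close> and \<open>a\<close> form a component of their own, so
        opposite colours on them suffice.\<close>
      case True
      then have ta: "t a = x" using bspec[OF psubset.prems(2) x] by auto
      have t': "\<forall>w\<in>?E. t w \<in> ?E \<and> t w \<noteq> w \<and> t (t w) = w"
      proof
        fix w assume "w \<in> ?E"
        then show "t w \<in> ?E \<and> t w \<noteq> w \<and> t (t w) = w"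
          using bspec[OF psubset.prems(2), of w] ta True by auto
      qed
      from psubset.IH[OF sub s' t'] obtain f :: "'a \<Rightarrow> bool"
        where f: "\<forall>w\<in>?E. f (s w) \<noteq> f w \<and> f (t w) \<noteq> f w" by blast
      have "(f(x := True, a := False)) (s w) \<noteq> (f(x := True, a := False)) w \<and>
            (f(x := True, a := False)) (t w) \<noteq> (f(x := True, a := False)) w" if "w \<in> E" for w
      proof (cases "w \<in> {x, a}")
        case True
        then show ?thesis using a ta \<open>t x = a\<close> by (auto simp: a_def)
      next
        case False
        then have w: "w \<in> ?E" using that by blast
        then have "s w \<in> ?E" "t w \<in> ?E" using s' t' by blast+
        then show ?thesis using bspec[OF f w] w by auto
      qed
      then show ?thesis by (intro exI[of _ "f(x := True, a := False)"] ballI)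
    next
      case False
      define p q where "p = t x" and "q = t a"
      have p: "p \<in> ?E" "t p = x" using bspec[OF psubset.prems(2) x] False by (auto simp: p_def)
      have q: "q \<in> ?E" "t q = a"
        using bspec[OF psubset.prems(2) a(1)] bspec[OF psubset.prems(2) x] False by (auto simp: q_def)
      have pq: "p \<noteq> q" using p q a by auto
      text \<open>Contract the path p, x, a, q to a single t-pair; a colouring of the rest extends over it.\<close>
      let ?t = "t(p := q, q := p)"
      have t': "\<forall>w\<in>?E. ?t w \<in> ?E \<and> ?t w \<noteq> w \<and> ?t (?t w) = w"
      proof
        fix w assume that: "w \<in> ?E"
        show "?t w \<in> ?E \<and> ?t w \<noteq> w \<and> ?t (?t w) = w"
        proof (cases "w \<in> {p, q}")
          case False
          have w: "t w \<in> E" "t w \<noteq> w" "t (t w) = w"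
            using bspec[OF psubset.prems(2), of w] that by auto
          \<comment> \<open>\<open>t\<close> swaps \<open>x\<close> with \<open>p\<close> and
            \<open>a\<close> with \<open>q\<close>, and \<open>w\<close> is none of these
            four.\<close>
          have "t w \<notin> {p, q, x, a}"
            using that w p q False by (metis DiffE insertCI insertE p_def q_def singletonD)
          then show ?thesis using w False by auto
        qed (use p q pq in auto)
      qed
      from psubset.IH[OF sub s' t'] obtain f :: "'a \<Rightarrow> bool"
        where f: "\<forall>w\<in>?E. f (s w) \<noteq> f w \<and> f (?t w) \<noteq> f w" by blast
      let ?f = "f(x := \<not> f p, a := \<not> f q)"
      \<comment> \<open>\<open>p\<close> and \<open>q\<close> are partners under the rewired
        \<open>t\<close>, so their colours differ. Hence \<open>x\<close> and \<open>a\<close>, each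
        coloured opposite to its \<open>t\<close>-neighbour, differ as well.\<close>
      have fpq: "f p \<noteq> f q" using f p q pq by (metis fun_upd_apply)
      have "?f (s w) \<noteq> ?f w \<and> ?f (t w) \<noteq> ?f w" if "w \<in> E" for w
      proof (cases "w \<in> {x, a}")
        case True
        moreover have "t x = p" "t a = q" "s x = a" by (simp_all add: a_def p_def q_def)
        moreover have "x \<noteq> p" "x \<noteq> q" "a \<noteq> p" "a \<noteq> q" using p q by auto
        ultimately show ?thesis using a fpq by (elim insertE) simp_all
      next
        case False
        then have w: "w \<in> ?E" using that by blast
        have "?f (s w) \<noteq> ?f w" using bspec[OF s' w] bspec[OF f w] w by auto
        moreover have "?f (t w) \<noteq> ?f w"
        proof (cases "w \<in> {p, q}")
          case True
          then show ?thesis using p q a by auto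
        next
          case F: False
          have "?t w \<in> ?E" "?t w = t w" using bspec[OF t' w] F by auto
          then show ?thesis using bspec[OF f w] w by auto
        qed
        ultimately show ?thesis by blast
      qed
      then show ?thesis by (intro exI[of _ ?f] ballI)
    qed
  qed simp
qed

text \<open>\<open>u\<close> flips the colour inside each fibre of \<open>k\<close>, so it matches
  the coloured elements of the fibre with the uncoloured ones.\<close>

lemma card_half_of_involution:
  assumes "finite E" and u: "\<forall>x\<in>E. u x \<in> E \<and> u (u x) = x \<and> k (u x) = k x \<and> f (u x) \<noteq> f x"
  shows "2 * card {x \<in> {x \<in> E. f x}. k x = b} = card {x \<in> E. k x = b}"
proof -
  let ?F = "{x \<in> E. f x}"
  have "bij_betw u {x \<in> ?F. k x = b} {x \<in> E - ?F. k x = b}"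
    by (rule bij_betw_byWitness[where f' = u]) (use u in auto)
  then have "card {x \<in> ?F. k x = b} = card {x \<in> E - ?F. k x = b}" by (rule bij_betw_same_card)
  moreover have "{x \<in> E. k x = b} = {x \<in> ?F. k x = b} \<union> {x \<in> E - ?F. k x = b}" by auto
  moreover have "card ({x \<in> ?F. k x = b} \<union> {x \<in> E - ?F. k x = b})
      = card {x \<in> ?F. k x = b} + card {x \<in> E - ?F. k x = b}"
    by (rule card_Un_disjoint) (use assms(1) in auto)
  ultimately show ?thesis by simp
qed

text \<open>Meant for cells with \<open>g = fst\<close> and \<open>h = snd\<close>: pair cells
  within rows by \<open>s\<close> and within columns by \<open>t\<close>. A colouring that
  alternates along both pairings halves all rows and columns simultaneously.\<close>

lemma balanced_split:
  assumes "finite E"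
    and "\<And>b. even (card {x \<in> E. g x = b})" and "\<And>b. even (card {x \<in> E. h x = b})"
  obtains F where "F \<subseteq> E"
    and "\<And>b. 2 * card {x \<in> F. g x = b} = card {x \<in> E. g x = b}"
    and "\<And>b. 2 * card {x \<in> F. h x = b} = card {x \<in> E. h x = b}"
proof -
  obtain s where s: "\<forall>x\<in>E. s x \<in> E \<and> s x \<noteq> x \<and> s (s x) = x \<and> g (s x) = g x"
    using pairing_within_fibres[OF assms(1,2)] by blast
  obtain t where t: "\<forall>x\<in>E. t x \<in> E \<and> t x \<noteq> x \<and> t (t x) = x \<and> h (t x) = h x"
    using pairing_within_fibres[OF assms(1,3)] by blast
  have "\<forall>x\<in>E. s x \<in> E \<and> s x \<noteq> x \<and> s (s x) = x"
    and "\<forall>x\<in>E. t x \<in> E \<and> t x \<noteq> x \<and> t (t x) = x"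
    using s t by auto
  from alternating_colouring[OF assms(1) this] obtain f :: "'a \<Rightarrow> bool"
    where f: "\<forall>x\<in>E. f (s x) \<noteq> f x \<and> f (t x) \<noteq> f x" by (elim exE)
  define F where "F = {x \<in> E. f x}"
  show ?thesis
  proof (rule that[of F])
    show "F \<subseteq> E" by (auto simp: F_def)
    show "2 * card {x \<in> F. g x = b} = card {x \<in> E. g x = b}" for b
      unfolding F_def by (rule card_half_of_involution[where u = s]) (use assms(1) s f in auto)
    show "2 * card {x \<in> F. h x = b} = card {x \<in> E. h x = b}" for b
      unfolding F_def by (rule card_half_of_involution[where u = t]) (use assms(1) t f in auto)
  qed
qed

section \<open>Superpositions of two sets with the same line sums\<close>

text \<open>Only the entries and the doubled line sums are recorded, not the two summands;
  \<open>superposition_split\<close> recovers summands. Entries are integers so that exchanges and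
  deviations can subtract freely.\<close>

definition superposition ::
    "'a set \<Rightarrow> 'b set \<Rightarrow> ('a \<Rightarrow> nat) \<Rightarrow> ('b \<Rightarrow> nat) \<Rightarrow> ('a \<Rightarrow> 'b \<Rightarrow> int) \<Rightarrow> bool" where
  "superposition I J r c y \<longleftrightarrow>
     (\<forall>i\<in>I. \<forall>j\<in>J. y i j \<in> {0, 1, 2}) \<and>
     (\<forall>i\<in>I. (\<Sum>j\<in>J. y i j) = 2 * int (r i)) \<and>
     (\<forall>j\<in>J. (\<Sum>i\<in>I. y i j) = 2 * int (c j))"

text \<open>On the values 0, 1, 2 the polynomial \<open>y (2 - y)\<close> is the indicator of 1, so this counts the
  cells covered exactly once.\<close>

definition single_cells :: "'a set \<Rightarrow> 'b set \<Rightarrow> ('a \<Rightarrow> 'b \<Rightarrow> int) \<Rightarrow> int" where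
  "single_cells I J y = (\<Sum>i\<in>I. \<Sum>j\<in>J. y i j * (2 - y i j))"

text \<open>Column \<open>a\<close> has at least the sum of column \<open>b\<close> but the smaller
  entry in row \<open>i\<close>, so some row \<open>k\<close> compensates with a larger entry in
  \<open>a\<close>. Move one unit from \<open>b\<close> to \<open>a\<close> in row \<open>i\<close>
  and back in row \<open>k\<close>. Each raised entry was below another entry and each lowered one
  above another, so values stay in 0, 1, 2. Row \<open>k\<close> never loses single cells, and row
  \<open>i\<close> accounts for the stated gain.\<close>

lemma superposition_exchange:
  assumes fin: "finite I" "finite J" and y: "superposition I J r c y"
    and i: "i \<in> I" and a: "a \<in> J" and b: "b \<in> J" and cab: "c b \<le> c a" and less: "y i a < y i b"
  obtains y' where "superposition I J r c y'"
    and "y' i = (y i)(a := y i a + 1, b := y i b - 1)"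
    and "single_cells I J y' \<ge> single_cells I J y + 2 * (y i b - y i a - 1)"
proof -
  have "\<exists>k\<in>I. y k b < y k a"
  proof (rule ccontr)
    assume "\<not> ?thesis"
    then have "(\<Sum>k\<in>I. y k a) < (\<Sum>k\<in>I. y k b)"
      by (intro sum_strict_mono_ex1) (use fin i less in \<open>auto simp: not_less\<close>)
    then show False using y a b cab by (auto simp: superposition_def)
  qed
  then obtain k where k: "k \<in> I" "y k b < y k a" by blast
  have ne: "k \<noteq> i" "a \<noteq> b" using k less by auto
  \<comment> \<open>The exchange adds the rank-one matrix \<open>D u * E j\<close>. Both factors sum
    to 0, which preserves all line sums, and weighted sums against them are differences of two
    values.\<close>
  define D :: "'a \<Rightarrow> int" where "D u = (if u = i then 1 else 0) - (if u = k then 1 else 0)" for u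
  define E :: "'b \<Rightarrow> int" where "E j = (if j = a then 1 else 0) - (if j = b then 1 else 0)" for j
  define y' where "y' u j = y u j + D u * E j" for u j
  have D0: "(\<Sum>u\<in>I. D u) = 0" and Dw: "(\<Sum>u\<in>I. D u * w u) = w i - w k" for w
    using fin i k by (auto simp: D_def sum_subtractf left_diff_distrib if_distrib[of "\<lambda>x. x * _"] cong: if_cong)
  have E0: "(\<Sum>j\<in>J. E j) = 0" and Ew: "(\<Sum>j\<in>J. E j * w j) = w a - w b" for w
    using fin a b by (auto simp: E_def sum_subtractf left_diff_distrib if_distrib[of "\<lambda>x. x * _"] cong: if_cong)
  have "superposition I J r c y'"
    unfolding superposition_def
  proof (intro conjI ballI)
    fix u j assume "u \<in> I" "j \<in> J"
    moreover have "y i a \<in> {0,1,2}" "y i b \<in> {0,1,2}" "y k a \<in> {0,1,2}" "y k b \<in> {0,1,2}"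
      using y i k a b by (auto simp: superposition_def)
    ultimately show "y' u j \<in> {0, 1, 2}"
      using y less k(2) ne by (auto simp: superposition_def y'_def D_def E_def)
  next
    fix u assume "u \<in> I"
    then show "(\<Sum>j\<in>J. y' u j) = 2 * int (r u)"
      using y E0 by (simp add: y'_def sum.distrib sum_distrib_left[symmetric] superposition_def)
  next
    fix j assume "j \<in> J"
    then show "(\<Sum>u\<in>I. y' u j) = 2 * int (c j)"
      using y D0 by (simp add: y'_def sum.distrib sum_distrib_right[symmetric] superposition_def)
  qed
  moreover have "y' i = (y i)(a := y i a + 1, b := y i b - 1)"
    using ne by (auto simp: fun_eq_iff y'_def D_def E_def)
  moreover have "single_cells I J y' \<ge> single_cells I J y + 2 * (y i b - y i a - 1)"
  proof -
    \<comment> \<open>Expand the quadratic in the perturbation; the correction carries a factor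
      \<open>E j\<close>, so \<open>Ew\<close> evaluates its sum at the columns \<open>a\<close> and
      \<open>b\<close>.\<close>
    have "(\<Sum>j\<in>J. y' u j * (2 - y' u j)) =
        (\<Sum>j\<in>J. y u j * (2 - y u j)) + D u * (2 * (y u b - y u a) - 2 * D u)" (is "?l = ?r") for u
    proof -
      have "?l = (\<Sum>j\<in>J. y u j * (2 - y u j) + D u * (E j * (2 - 2 * y u j - D u * E j)))"
        by (rule sum.cong) (simp_all add: y'_def algebra_simps)
      also have "\<dots> = (\<Sum>j\<in>J. y u j * (2 - y u j))
          + D u * (\<Sum>j\<in>J. E j * (2 - 2 * y u j - D u * E j))"
        by (simp only: sum.distrib sum_distrib_left)
      also have "\<dots> = ?r" using ne by (simp only: Ew) (simp add: E_def algebra_simps)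
      finally show ?thesis .
    qed
    then have "single_cells I J y' = single_cells I J y
        + (\<Sum>u\<in>I. D u * (2 * (y u b - y u a) - 2 * D u))"
      by (simp add: single_cells_def sum.distrib)
    also have "\<dots> = single_cells I J y + 2 * (y i b - y i a) + 2 * (y k a - y k b) - 4"
      using ne by (simp only: Dw) (simp add: D_def algebra_simps)
    finally show ?thesis using k(2) by simp
  qed
  ultimately show ?thesis using that by blast
qed

section \<open>Deviation of a row from the left-justified row\<close>

text \<open>The deviation is \<open>2 - y j\<close> on the first \<open>r\<close> cells and
  \<open>y j\<close> on the others. The row sum \<open>2 * r\<close> makes these two parts equal, so
  either one is half of the total.\<close>

lemma row_deviation:
  fixes y :: "nat \<Rightarrow> int"
  assumes val: "\<And>j. j \<in> {1..n} \<Longrightarrow> y j \<in> {0, 1, 2}"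
    and total: "(\<Sum>j=1..n. y j) = 2 * int r" and "r \<le> n"
  shows "(\<Sum>j=1..n. \<bar>y j - 2 * of_bool (j \<le> r)\<bar>) = 2 * (\<Sum>j=Suc r..n. y j)"
    and "(\<Sum>j=Suc r..n. y j) = (\<Sum>j=1..r. 2 - y j)"
proof -
  have un: "{1..n} = {1..r} \<union> {Suc r..n}" using \<open>r \<le> n\<close> by auto
  have split: "(\<Sum>j=1..n. w j) = (\<Sum>j=1..r. w j) + (\<Sum>j=Suc r..n. w j)" for w :: "nat \<Rightarrow> int"
    unfolding un by (rule sum.union_disjoint) auto
  show eq: "(\<Sum>j=Suc r..n. y j) = (\<Sum>j=1..r. 2 - y j)"
    using total unfolding split by (simp add: sum_subtractf)
  have "(\<Sum>j=1..r. \<bar>y j - 2 * of_bool (j \<le> r)\<bar>) = (\<Sum>j=1..r. 2 - y j)"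
  proof (rule sum.cong[OF refl])
    fix j assume "j \<in> {1..r}"
    then show "\<bar>y j - 2 * of_bool (j \<le> r)\<bar> = 2 - y j" using val[of j] \<open>r \<le> n\<close> by auto
  qed
  moreover have "(\<Sum>j=Suc r..n. \<bar>y j - 2 * of_bool (j \<le> r)\<bar>) = (\<Sum>j=Suc r..n. y j)"
  proof (rule sum.cong[OF refl])
    fix j assume "j \<in> {Suc r..n}"
    then show "\<bar>y j - 2 * of_bool (j \<le> r)\<bar> = y j" using val[of j] by auto
  qed
  ultimately show "(\<Sum>j=1..n. \<bar>y j - 2 * of_bool (j \<le> r)\<bar>) = 2 * (\<Sum>j=Suc r..n. y j)"
    using eq unfolding split by simp
qed

lemma row_deviation_le:
  fixes y :: "nat \<Rightarrow> int"
  assumes val: "\<And>j. j \<in> {1..n} \<Longrightarrow> y j \<in> {0, 1, 2}"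
    and total: "(\<Sum>j=1..n. y j) = 2 * int r" and rn: "r \<le> n"
    and no02: "\<And>a b. 1 \<le> a \<Longrightarrow> a < b \<Longrightarrow> b \<le> n \<Longrightarrow> y a = 0 \<Longrightarrow> y b \<noteq> 2"
  defines "dev \<equiv> (\<Sum>j=1..n. \<bar>y j - 2 * of_bool (j \<le> r)\<bar>)"
    and "ones \<equiv> (\<Sum>j=1..n. y j * (2 - y j))"
  shows "dev \<le> 2 * ones"
    and "1 \<le> a \<Longrightarrow> a \<le> r \<Longrightarrow> y a = 1 \<Longrightarrow> \<forall>b\<in>{Suc r..n}. y b \<noteq> 2 \<Longrightarrow> dev < 2 * ones"
    and "r < b \<Longrightarrow> b \<le> n \<Longrightarrow> y b = 1 \<Longrightarrow> \<forall>a\<in>{1..r}. y a \<noteq> 0 \<Longrightarrow> dev < 2 * ones"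
proof -
  note rd = row_deviation[OF val total rn, folded dev_def]
  have un: "{1..n} = {1..r} \<union> {Suc r..n}" using \<open>r \<le> n\<close> by auto
  have split: "ones = (\<Sum>j=1..r. y j * (2 - y j)) + (\<Sum>j=Suc r..n. y j * (2 - y j))"
    unfolding ones_def un by (rule sum.union_disjoint) auto
  have nonneg: "0 \<le> y j * (2 - y j)" if "j \<in> {1..n}" for j using val[OF that] by auto
  have in0: "0 \<le> (\<Sum>j=1..r. y j * (2 - y j))" and out0: "0 \<le> (\<Sum>j=Suc r..n. y j * (2 - y j))"
    using rn by (auto intro!: sum_nonneg nonneg simp del: mult_nonneg_nonneg)
  have in1: "1 \<le> (\<Sum>j=1..r. y j * (2 - y j))" if "1 \<le> a" "a \<le> r" "y a = 1" for a
  proof -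
    have "y a * (2 - y a) \<le> (\<Sum>j=1..r. y j * (2 - y j))"
      by (rule member_le_sum) (use that rn in \<open>auto intro!: nonneg\<close>)
    then show ?thesis using that by simp
  qed
  have out1: "1 \<le> (\<Sum>j=Suc r..n. y j * (2 - y j))" if "r < b" "b \<le> n" "y b = 1" for b
  proof -
    have "y b * (2 - y b) \<le> (\<Sum>j=Suc r..n. y j * (2 - y j))"
      by (rule member_le_sum) (use that rn in \<open>auto intro!: nonneg\<close>)
    then show ?thesis using that by simp
  qed
  \<comment> \<open>For values 0 and 1 the entry equals its indicator
    \<open>y j * (2 - y j)\<close>; in \<open>no0\<close> the same holds for \<open>2 - y j\<close>
    on values 1 and 2.\<close>
  have no2: "dev = 2 * (\<Sum>j=Suc r..n. y j * (2 - y j))" if "\<forall>b\<in>{Suc r..n}. y b \<noteq> 2"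
  proof -
    have "(\<Sum>j=Suc r..n. y j) = (\<Sum>j=Suc r..n. y j * (2 - y j))"
    proof (rule sum.cong[OF refl])
      fix j assume "j \<in> {Suc r..n}"
      then show "y j = y j * (2 - y j)" using val[of j] that by auto
    qed
    then show ?thesis using rd by simp
  qed
  have no0: "dev = 2 * (\<Sum>j=1..r. y j * (2 - y j))" if "\<forall>a\<in>{1..r}. y a \<noteq> 0"
  proof -
    have "(\<Sum>j=1..r. 2 - y j) = (\<Sum>j=1..r. y j * (2 - y j))"
    proof (rule sum.cong[OF refl])
      fix j assume "j \<in> {1..r}"
      then show "2 - y j = y j * (2 - y j)" using val[of j] that rn by auto
    qed
    then show ?thesis using rd by simp
  qed
  have dich: "(\<forall>b\<in>{Suc r..n}. y b \<noteq> 2) \<or> (\<forall>a\<in>{1..r}. y a \<noteq> 0)"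
    using no02 by fastforce
  show "dev \<le> 2 * ones" using dich no2 no0 split in0 out0 by linarith
  show "dev < 2 * ones" if "1 \<le> a" "a \<le> r" "y a = 1" "\<forall>b\<in>{Suc r..n}. y b \<noteq> 2"
    using no2[OF that(4)] split in1[OF that(1-3)] by linarith
  show "dev < 2 * ones" if "r < b" "b \<le> n" "y b = 1" "\<forall>a\<in>{1..r}. y a \<noteq> 0"
    using no0[OF that(4)] split out1[OF that(1-3)] by linarith
qed

section \<open>Superpositions with the most single cells\<close>

lemma maximal_superposition_exists:
  assumes "finite I" "finite J" and "superposition I J r c y0"
  obtains y where "superposition I J r c y" and "single_cells I J y0 \<le> single_cells I J y"
    and "\<And>y'. superposition I J r c y' \<Longrightarrow> single_cells I J y' \<le> single_cells I J y"
proof -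
  have nonneg: "0 \<le> single_cells I J y" and bound: "single_cells I J y \<le> int (card I) * int (card J)"
    if "superposition I J r c y" for y
  proof -
    have val: "y i j \<in> {0, 1, 2}" if "i \<in> I" "j \<in> J" for i j
      using \<open>superposition I J r c y\<close> that by (auto simp: superposition_def)
    show "0 \<le> single_cells I J y"
      unfolding single_cells_def
      by (intro sum_nonneg) (use val in fastforce)
    have "single_cells I J y \<le> (\<Sum>i\<in>I. \<Sum>j\<in>J. 1)"
      unfolding single_cells_def
      by (intro sum_mono) (use val in fastforce)
    then show "single_cells I J y \<le> int (card I) * int (card J)" by simp
  qed
  \<comment> \<open>The count is nonnegative and at most the number of cells, so passing to
    \<open>nat\<close> loses nothing and a maximum is attained.\<close>
  have "\<forall>y. superposition I J r c y \<longrightarrow> nat (single_cells I J y) < Suc (card I * card J)"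
    using bound by (metis less_Suc_eq_le nat_le_iff of_nat_mult)
  from ex_has_greatest_nat[OF assms(3) this] obtain y where y: "superposition I J r c y"
    and max: "\<forall>y'. superposition I J r c y' \<longrightarrow> nat (single_cells I J y') \<le> nat (single_cells I J y)"
    by blast
  have "single_cells I J y' \<le> single_cells I J y" if "superposition I J r c y'" for y'
    using max nonneg[OF y] that by (metis nat_le_eq_zle nonneg nat_mono le_cases)
  with y assms(3) show ?thesis using that by blast
qed

text \<open>Column \<open>j\<close> of \<open>y\<close> minus twice the left-justified matrix sums
  to twice \<open>c j\<close> minus the number of rows reaching \<open>j\<close>. The triangle
  inequality in each column and a swap of summations finish.\<close>

lemma column_deviation_le:
  assumes "finite I" and y: "superposition I {1..n} r c y"
  shows "2 * (\<Sum>j=1..n. \<bar>int (c j) - int (card {i \<in> I. j \<le> r i})\<bar>)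
    \<le> (\<Sum>i\<in>I. \<Sum>j=1..n. \<bar>y i j - 2 * of_bool (j \<le> r i)\<bar>)"
proof -
  have "2 * \<bar>int (c j) - int (card {i \<in> I. j \<le> r i})\<bar>
      \<le> (\<Sum>i\<in>I. \<bar>y i j - 2 * of_bool (j \<le> r i)\<bar>)" if "j \<in> {1..n}" for j
  proof -
    have "(\<Sum>i\<in>I. y i j - 2 * of_bool (j \<le> r i)) = 2 * int (c j) - 2 * (\<Sum>i\<in>I. of_bool (j \<le> r i))"
      using y that by (simp only: sum_subtractf sum_distrib_left superposition_def)
    also have "(\<Sum>i\<in>I. of_bool (j \<le> r i)) = int (card {i \<in> I. j \<le> r i})"
      using assms(1) by (simp add: Int_def)
    finally have "2 * \<bar>int (c j) - int (card {i \<in> I. j \<le> r i})\<bar>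
        = \<bar>\<Sum>i\<in>I. y i j - 2 * of_bool (j \<le> r i)\<bar>" by (simp only: abs_if) simp
    then show ?thesis by (simp only: sum_abs)
  qed
  then have "(\<Sum>j=1..n. 2 * \<bar>int (c j) - int (card {i \<in> I. j \<le> r i})\<bar>)
      \<le> (\<Sum>j=1..n. \<Sum>i\<in>I. \<bar>y i j - 2 * of_bool (j \<le> r i)\<bar>)"
    by (rule sum_mono)
  then show ?thesis by (subst sum.swap) (simp only: sum_distrib_left)
qed

text \<open>Row by row, deviation is at most twice the ones for every maximal matrix; summation
  gives the weak inequality. Strictness needs only one strict row in one maximal matrix, and
  exchanges allow moving from \<open>y\<close> to a suitable one.\<close>

lemma maximal_superposition_gt:
  assumes fin: "finite I" and y: "superposition I {1..n} r c y"
    and max: "\<And>y'. superposition I {1..n} r c y' \<Longrightarrow> single_cells I {1..n} y' \<le> single_cells I {1..n} y"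
    and pos: "0 < single_cells I {1..n} y"
    and c_mono: "\<And>a b. 1 \<le> a \<Longrightarrow> a < b \<Longrightarrow> b \<le> n \<Longrightarrow> c b \<le> c a"
    and rn: "\<And>i. i \<in> I \<Longrightarrow> r i \<le> n"
  shows "(\<Sum>j=1..n. \<bar>int (c j) - int (card {i \<in> I. j \<le> r i})\<bar>) < single_cells I {1..n} y"
proof -
  let ?s = "single_cells I {1..n}"
  let ?dev = "\<lambda>z i. \<Sum>j=1..n. \<bar>z i j - 2 * of_bool (j \<le> r i)\<bar>"
  let ?ones = "\<lambda>z i. \<Sum>j=1..n. z i j * (2 - z i j :: int)"
  define opt where "opt z \<longleftrightarrow> superposition I {1..n} r c z \<and> ?s z = ?s y" for z
  \<comment> \<open>An exchange with \<open>z i a < z i b\<close> never lowers the count, so it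
    leads from a maximal matrix to a maximal one. A difference of 2 would raise the count, hence the
    bound 1.\<close>
  have exch: "\<exists>z'. opt z' \<and> z' i = (z i)(a := z i a + 1, b := z i b - 1) \<and> z i b - z i a \<le> 1"
    if z: "opt z" and i: "i \<in> I" and ab: "1 \<le> a" "a < b" "b \<le> n" and less: "z i a < z i b" for z i a b
  proof -
    have z_sup: "superposition I {1..n} r c z" and "a \<in> {1..n}" "b \<in> {1..n}" "c b \<le> c a"
      using z ab c_mono by (auto simp: opt_def)
    from superposition_exchange[OF fin finite_atLeastAtMost this(1) i this(2-4) less]
    obtain z' where z': "superposition I {1..n} r c z'"
      "z' i = (z i)(a := z i a + 1, b := z i b - 1)" "?s z' \<ge> ?s z + 2 * (z i b - z i a - 1)"
      by blast
    then show ?thesis using max[OF z'(1)] z less by (auto simp: opt_def)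
  qed
  have no02: "z i b \<noteq> 2" if "opt z" "i \<in> I" "1 \<le> a" "a < b" "b \<le> n" "z i a = 0" for z i a b
    using exch[OF that(1-5)] that(6) by auto
  have val: "z i j \<in> {0, 1, 2}" if "opt z" "i \<in> I" "j \<in> {1..n}" for z i j
    using that by (auto simp: opt_def superposition_def)
  have row_le: "?dev z i \<le> 2 * ?ones z i"
    and strict_in: "1 \<le> a \<Longrightarrow> a \<le> r i \<Longrightarrow> z i a = 1 \<Longrightarrow> \<forall>b\<in>{Suc (r i)..n}. z i b \<noteq> 2
      \<Longrightarrow> ?dev z i < 2 * ?ones z i"
    and strict_out: "r i < b \<Longrightarrow> b \<le> n \<Longrightarrow> z i b = 1 \<Longrightarrow> \<forall>a\<in>{1..r i}. z i a \<noteq> 0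
      \<Longrightarrow> ?dev z i < 2 * ?ones z i"
    if z: "opt z" and i: "i \<in> I" for z i a b
  proof -
    have total: "(\<Sum>j=1..n. z i j) = 2 * int (r i)" using z i by (auto simp: opt_def superposition_def)
    note rd = row_deviation_le[of n "z i" "r i", OF val[OF z i] total rn[OF i] no02[OF z i]]
    show "?dev z i \<le> 2 * ?ones z i" by (rule rd(1))
    show "?dev z i < 2 * ?ones z i"
      if "1 \<le> a" "a \<le> r i" "z i a = 1" "\<forall>b\<in>{Suc (r i)..n}. z i b \<noteq> 2"
      by (rule rd(2)[OF _ _ _ _ _ that])
    show "?dev z i < 2 * ?ones z i"
      if "r i < b" "b \<le> n" "z i b = 1" "\<forall>a\<in>{1..r i}. z i a \<noteq> 0"
      by (rule rd(3)[OF _ _ _ _ _ that])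
  qed
  have "\<exists>z i. opt z \<and> i \<in> I \<and> ?dev z i < 2 * ?ones z i"
  proof -
    have y: "opt y" using y by (simp add: opt_def)
    obtain i j where i: "i \<in> I" and j: "j \<in> {1..n}" and ij: "y i j = 1"
    proof (rule ccontr)
      assume "\<not> thesis"
      then have "\<forall>i\<in>I. \<forall>j\<in>{1..n}. y i j * (2 - y i j) = 0" using val[OF y] that by fastforce
      then have "?s y = 0" unfolding single_cells_def by (intro sum.neutral ballI) blast
      then show False using pos by simp
    qed
    show ?thesis
    proof (cases "\<exists>a\<in>{1..r i}. y i a = 0")
      case True
      then obtain a where a: "1 \<le> a" "a \<le> r i" "y i a = 0" by auto
      have no2: "\<forall>b\<in>{Suc (r i)..n}. y i b \<noteq> 2" using no02[OF y i a(1)] a by auto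
      show ?thesis
      proof (cases "j \<le> r i")
        case True
        then show ?thesis using strict_in[OF y i, of j] j ij no2 y i by auto
      next
        case False
        \<comment> \<open>The 0 at \<open>a\<close> becomes 1 and the 1 at \<open>j\<close> becomes
          0: the one moves inside, and there is still no 2 outside.\<close>
        obtain z where z: "opt z" "z i = (y i)(a := y i a + 1, j := y i j - 1)"
          using exch[OF y i, of a j] a j ij False by auto
        have "?dev z i < 2 * ?ones z i"
          by (rule strict_in[OF z(1) i, of a]) (use z(2) a False no2 ij in auto)
        then show ?thesis using z i by blast
      qed
    next
      case no0: False
      show ?thesis
      proof (cases "r i < j")
        case True
        then show ?thesis using strict_out[OF y i, of j] j ij no0 y i by auto
      next
        case j_in: False
        show ?thesis
        proof (cases "\<exists>b\<in>{Suc (r i)..n}. y i b = 2")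
          case True
          then obtain b where b: "r i < b" "b \<le> n" "y i b = 2"
            by (auto simp: Suc_le_eq)
          \<comment> \<open>The 1 at \<open>j\<close> becomes 2 and the 2 at \<open>b\<close>
            becomes 1: now a one lies outside, and there is still no 0 inside.\<close>
          obtain z where z: "opt z" "z i = (y i)(j := y i j + 1, b := y i b - 1)"
            using exch[OF y i, of j b] b j ij j_in by auto
          have "?dev z i < 2 * ?ones z i"
            by (rule strict_out[OF z(1) i, of b]) (use z(2) b j_in no0 ij in auto)
          then show ?thesis using z i by blast
        next
          case False
          then show ?thesis using strict_in[OF y i, of j] j ij j_in y i by auto
        qed
      qed
    qed
  qed
  then obtain z i where z: "opt z" and i: "i \<in> I" "?dev z i < 2 * ?ones z i" by blast
  have "2 * (\<Sum>j=1..n. \<bar>int (c j) - int (card {i \<in> I. j \<le> r i})\<bar>) \<le> (\<Sum>i\<in>I. ?dev z i)"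
    by (rule column_deviation_le[OF fin]) (use z in \<open>simp add: opt_def\<close>)
  also have "\<dots> < (\<Sum>i\<in>I. 2 * ?ones z i)"
    by (rule sum_strict_mono_ex1[OF fin]) (use row_le[OF z] i in auto)
  also have "\<dots> = 2 * ?s y" using z by (simp add: opt_def single_cells_def flip: sum_distrib_left)
  finally show ?thesis by simp
qed

section \<open>Parity of the single cells and of the column deviation\<close>

text \<open>Write \<open>y * (2 - y)\<close> as \<open>y * (3 - y) - y\<close>: the product is even
  for every integer, and the entries of a row add up to an even number.\<close>

lemma single_cells_even:
  assumes "superposition I J r c y"
  shows "even (single_cells I J y)"
proof -
  have "(\<Sum>j\<in>J. y i j * (2 - y i j)) = (\<Sum>j\<in>J. y i j * (3 - y i j)) - 2 * int (r i)" if "i \<in> I" for i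
  proof -
    have "(\<Sum>j\<in>J. y i j * (2 - y i j)) = (\<Sum>j\<in>J. y i j * (3 - y i j) - y i j)"
      by (rule sum.cong) (simp_all add: algebra_simps)
    then show ?thesis using assms that by (simp add: superposition_def sum_subtractf)
  qed
  moreover have "even (\<Sum>j\<in>J. y i j * (3 - y i j))" for i by (rule dvd_sum) simp
  ultimately have "even (\<Sum>j\<in>J. y i j * (2 - y i j))" if "i \<in> I" for i using that by simp
  then show ?thesis unfolding single_cells_def by (rule dvd_sum)
qed

text \<open>The column sums of \<open>c\<close> and of the left-justified matrix have the same
  total, so the signed deviations cancel. Replacing each by its absolute value changes the sum by
  even amounts.\<close>

lemma column_deviation_even:
  assumes fin: "finite I" and y: "superposition I {1..n} r c y"
    and rn: "\<And>i. i \<in> I \<Longrightarrow> r i \<le> n"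
  shows "even (\<Sum>j=1..n. \<bar>int (c j) - int (card {i \<in> I. j \<le> r i})\<bar>)"
proof -
  let ?x = "\<lambda>j. int (c j) - int (card {i \<in> I. j \<le> r i})"
  have "2 * (\<Sum>j=1..n. int (c j)) = (\<Sum>j=1..n. \<Sum>i\<in>I. y i j)"
    using y by (simp add: superposition_def sum_distrib_left)
  also have "\<dots> = 2 * (\<Sum>i\<in>I. int (r i))"
    using y by (subst sum.swap) (simp add: superposition_def sum_distrib_left)
  finally have c: "(\<Sum>j=1..n. int (c j)) = (\<Sum>i\<in>I. int (r i))" by simp
  have "(\<Sum>j=1..n. int (card {i \<in> I. j \<le> r i})) = (\<Sum>j=1..n. \<Sum>i\<in>I. of_bool (j \<le> r i))"
    using fin by (simp add: Int_def)
  also have "\<dots> = (\<Sum>i\<in>I. \<Sum>j=1..n. of_bool (j \<le> r i))" by (rule sum.swap)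
  also have "\<dots> = (\<Sum>i\<in>I. int (r i))"
  proof (rule sum.cong[OF refl])
    fix i assume "i \<in> I"
    then have "{1..n} \<inter> {j. j \<le> r i} = {1..r i}" using rn by fastforce
    then show "(\<Sum>j=1..n. of_bool (j \<le> r i)) = int (r i)" by simp
  qed
  finally have "(\<Sum>j=1..n. ?x j) = 0" using c by (simp add: sum_subtractf)
  then have "(\<Sum>j=1..n. \<bar>?x j\<bar>) = (\<Sum>j=1..n. \<bar>?x j\<bar> - ?x j)" by (simp only: sum_subtractf)
  moreover have "even (\<Sum>j=1..n. \<bar>?x j\<bar> - ?x j)" by (rule dvd_sum) (auto simp: abs_if)
  ultimately show ?thesis by metis
qed

section \<open>Splitting a superposition into two sets\<close>

text \<open>Even line sums leave an even number of ones in every line, so the ones \<open>E\<close>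
  split into halves balanced in all lines. Both sets take the twos \<open>T\<close> and one half
  each; their symmetric difference is \<open>E\<close>.\<close>

lemma superposition_split:
  assumes fin: "finite I" "finite J" and y: "superposition I J r c y"
  obtains P Q where "P \<subseteq> I \<times> J" and "Q \<subseteq> I \<times> J"
    and "\<And>i. i \<in> I \<Longrightarrow> card {x \<in> P. fst x = i} = r i" and "\<And>i. i \<in> I \<Longrightarrow> card {x \<in> Q. fst x = i} = r i"
    and "\<And>j. j \<in> J \<Longrightarrow> card {x \<in> P. snd x = j} = c j" and "\<And>j. j \<in> J \<Longrightarrow> card {x \<in> Q. snd x = j} = c j"
    and "int (card (sym_diff P Q)) = single_cells I J y"
proof -
  define E where "E = {x \<in> I \<times> J. y (fst x) (snd x) = 1}"
  define T where "T = {x \<in> I \<times> J. y (fst x) (snd x) = 2}"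
  have val: "y i j = of_bool (y i j = 1) + 2 * of_bool (y i j = 2)" if "i \<in> I" "j \<in> J" for i j
    using y that by (auto simp: superposition_def)
  have finE: "finite E" and finT: "finite T" using fin by (auto simp: E_def T_def)
  have rows: "card {x \<in> E. fst x = i} + 2 * card {x \<in> T. fst x = i} = 2 * r i" if "i \<in> I" for i
  proof -
    have *: "int (card {x \<in> {x \<in> I \<times> J. y (fst x) (snd x) = k}. fst x = i})
        = (\<Sum>j\<in>J. of_bool (y i j = k))" for k
    proof -
      have "{x \<in> {x \<in> I \<times> J. y (fst x) (snd x) = k}. fst x = i} = Pair i ` {j \<in> J. y i j = k}"
        using that by auto
      then show ?thesis using fin by (simp add: card_image inj_on_def Int_def)
    qed
    have "2 * int (r i) = (\<Sum>j\<in>J. of_bool (y i j = 1) + 2 * of_bool (y i j = 2))"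
      using y that val by (simp add: superposition_def cong: sum.cong)
    then have "int (card {x \<in> E. fst x = i}) + 2 * int (card {x \<in> T. fst x = i}) = 2 * int (r i)"
      unfolding E_def T_def * by (simp only: sum.distrib sum_distrib_left)
    then show ?thesis by linarith
  qed
  have columns: "card {x \<in> E. snd x = j} + 2 * card {x \<in> T. snd x = j} = 2 * c j" if "j \<in> J" for j
  proof -
    have *: "int (card {x \<in> {x \<in> I \<times> J. y (fst x) (snd x) = k}. snd x = j})
        = (\<Sum>i\<in>I. of_bool (y i j = k))" for k
    proof -
      have "{x \<in> {x \<in> I \<times> J. y (fst x) (snd x) = k}. snd x = j} = (\<lambda>i. (i, j)) ` {i \<in> I. y i j = k}"
        using that by auto
      then show ?thesis using fin by (simp add: card_image inj_on_def Int_def)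
    qed
    have "2 * int (c j) = (\<Sum>i\<in>I. of_bool (y i j = 1) + 2 * of_bool (y i j = 2))"
      using y that val by (simp add: superposition_def cong: sum.cong)
    then have "int (card {x \<in> E. snd x = j}) + 2 * int (card {x \<in> T. snd x = j}) = 2 * int (c j)"
      unfolding E_def T_def * by (simp only: sum.distrib sum_distrib_left)
    then show ?thesis by linarith
  qed
  have even_rows: "even (card {x \<in> E. fst x = i})" for i
  proof (cases "i \<in> I")
    case True
    then show ?thesis using rows[OF True] by presburger
  next
    case False
    then have "{x \<in> E. fst x = i} = {}" by (auto simp: E_def)
    then show ?thesis by (simp only: card.empty even_zero)
  qed
  have even_columns: "even (card {x \<in> E. snd x = j})" for j
  proof (cases "j \<in> J")
    case True
    then show ?thesis using columns[OF True] by presburger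
  next
    case False
    then have "{x \<in> E. snd x = j} = {}" by (auto simp: E_def)
    then show ?thesis by (simp only: card.empty even_zero)
  qed
  obtain F where F: "F \<subseteq> E"
    "\<And>i. 2 * card {x \<in> F. fst x = i} = card {x \<in> E. fst x = i}"
    "\<And>j. 2 * card {x \<in> F. snd x = j} = card {x \<in> E. snd x = j}"
    using balanced_split[OF finE even_rows even_columns] by blast
  have finF: "finite F" using F(1) finE by (rule finite_subset)
  have disj: "T \<inter> E = {}" by (auto simp: E_def T_def)
  have P: "card {x \<in> T \<union> F. p x} = card {x \<in> T. p x} + card {x \<in> F. p x}" for p
  proof -
    have "{x \<in> T \<union> F. p x} = {x \<in> T. p x} \<union> {x \<in> F. p x}" by auto
    then show ?thesis using finT finF disj F(1) by (auto intro!: card_Un_disjoint)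
  qed
  have Q: "card {x \<in> T \<union> (E - F). p x} = card {x \<in> T. p x} + (card {x \<in> E. p x} - card {x \<in> F. p x})" for p
  proof -
    have "{x \<in> T \<union> (E - F). p x} = {x \<in> T. p x} \<union> ({x \<in> E. p x} - {x \<in> F. p x})" by auto
    moreover have "card ({x \<in> E. p x} - {x \<in> F. p x}) = card {x \<in> E. p x} - card {x \<in> F. p x}"
      by (rule card_Diff_subset) (use finF F(1) in auto)
    moreover have "card ({x \<in> T. p x} \<union> ({x \<in> E. p x} - {x \<in> F. p x}))
        = card {x \<in> T. p x} + card ({x \<in> E. p x} - {x \<in> F. p x})"
      by (rule card_Un_disjoint) (use finT finE disj in auto)
    ultimately show ?thesis by simp
  qed
  show ?thesis
  proof (rule that[of "T \<union> F" "T \<union> (E - F)"])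
    show "T \<union> F \<subseteq> I \<times> J" "T \<union> (E - F) \<subseteq> I \<times> J" using F(1) by (auto simp: E_def T_def)
    show "card {x \<in> T \<union> F. fst x = i} = r i" "card {x \<in> T \<union> (E - F). fst x = i} = r i" if "i \<in> I" for i
      using rows[OF that] F(2)[of i] unfolding P Q by linarith+
    show "card {x \<in> T \<union> F. snd x = j} = c j" "card {x \<in> T \<union> (E - F). snd x = j} = c j" if "j \<in> J" for j
      using columns[OF that] F(3)[of j] unfolding P Q by linarith+
    have "sym_diff (T \<union> F) (T \<union> (E - F)) = E" using F(1) disj by auto
    moreover have "single_cells I J y = (\<Sum>x\<in>I \<times> J. of_bool (y (fst x) (snd x) = 1))"
      unfolding single_cells_def sum.cartesian_product
    proof (rule sum.cong[OF refl], clarify)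
      fix i j assume "i \<in> I" "j \<in> J"
      then have "y i j \<in> {0, 1, 2}" using y by (auto simp: superposition_def)
      then show "y i j * (2 - y i j) = of_bool (y (fst (i, j)) (snd (i, j)) = 1)" by auto
    qed
    ultimately show "int (card (sym_diff (T \<union> F) (T \<union> (E - F)))) = single_cells I J y"
      using fin by (simp add: E_def Int_def)
  qed
qed

section \<open>Line sums\<close>

text \<open>Natural indices fit the list positions. Containment in the rectangle encodes both
  finiteness and the vanishing of all other line sums.\<close>

definition nat_line_sums :: "nat list \<Rightarrow> nat list \<Rightarrow> (nat \<times> nat) set \<Rightarrow> bool" where
  "nat_line_sums R C P \<longleftrightarrow>
     P \<subseteq> {1..length R} \<times> {1..length C} \<and>
     (\<forall>i\<in>{1..length R}. card {x \<in> P. fst x = i} = R ! (i - 1)) \<and>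
     (\<forall>j\<in>{1..length C}. card {x \<in> P. snd x = j} = C ! (j - 1))"

abbreviation int_cells :: "(nat \<times> nat) set \<Rightarrow> (int \<times> int) set" where
  "int_cells P \<equiv> map_prod int int ` P"

lemma inj_map_prod_int: "inj (map_prod int int)"
  by (intro prod.inj_map inj_of_nat)

lemma row_sum_int_cells: "row_sum (int_cells P) (int i) = card {x \<in> P. fst x = i}"
proof -
  have "int_cells P \<inter> row (int i) = int_cells {x \<in> P. fst x = i}" by (auto simp: row_def)
  then show ?thesis
    unfolding row_sum_def by (simp add: card_image inj_on_subset[OF inj_map_prod_int])
qed

lemma column_sum_int_cells: "column_sum (int_cells P) (int j) = card {x \<in> P. snd x = j}"
proof -
  have "int_cells P \<inter> column (int j) = int_cells {x \<in> P. snd x = j}" by (auto simp: column_def)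
  then show ?thesis
    unfolding column_sum_def by (simp add: card_image inj_on_subset[OF inj_map_prod_int])
qed

lemma has_line_sums_int_cells:
  assumes "nat_line_sums R C P"
  shows "has_line_sums R C (int_cells P)"
  unfolding has_line_sums_def
proof (intro conjI ballI allI impI)
  have sub: "P \<subseteq> {1..length R} \<times> {1..length C}" using assms by (simp add: nat_line_sums_def)
  then show "finite (int_cells P)" by (intro finite_imageI) (auto intro: finite_subset)
  show "row_sum (int_cells P) (int i) = R ! (i - 1)" if "i \<in> {1..length R}" for i
    using assms that by (simp add: row_sum_int_cells nat_line_sums_def)
  show "column_sum (int_cells P) (int j) = C ! (j - 1)" if "j \<in> {1..length C}" for j
    using assms that by (simp add: column_sum_int_cells nat_line_sums_def)
  show "row_sum (int_cells P) i = 0" if "i \<notin> {1..int (length R)}" for i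
  proof -
    have "int_cells P \<inter> row i = {}" using sub that by (fastforce simp: row_def)
    then show ?thesis by (simp add: row_sum_def)
  qed
  show "column_sum (int_cells P) j = 0" if "j \<notin> {1..int (length C)}" for j
  proof -
    have "int_cells P \<inter> column j = {}" using sub that by (fastforce simp: column_def)
    then show ?thesis by (simp add: column_sum_def)
  qed
qed

text \<open>In a finite set, a line through a cell has nonzero sum, so its index is in range. All
  coordinates are therefore positive and survive the conversion to \<open>nat\<close>.\<close>

lemma has_line_sumsE:
  assumes "has_line_sums R C F"
  obtains P where "nat_line_sums R C P" and "F = int_cells P"
proof -
  have fin: "finite F" using assms by (simp add: has_line_sums_def)
  have rows: "fst x \<in> {1..int (length R)}" and columns: "snd x \<in> {1..int (length C)}" if "x \<in> F" for x
  proof -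
    have "x \<in> F \<inter> row (fst x)" "x \<in> F \<inter> column (snd x)"
      using that by (auto simp: row_def column_def)
    then have "row_sum F (fst x) \<noteq> 0" "column_sum F (snd x) \<noteq> 0"
      using fin by (auto simp: row_sum_def column_sum_def)
    then show "fst x \<in> {1..int (length R)}" "snd x \<in> {1..int (length C)}"
      using assms by (auto simp: has_line_sums_def)
  qed
  define P where "P = map_prod nat nat ` F"
  have F: "F = int_cells P"
  proof -
    have "map_prod int int (map_prod nat nat x) = x" if "x \<in> F" for x
      using rows[OF that] columns[OF that] by (cases x) auto
    then show ?thesis by (simp add: P_def image_image)
  qed
  have "P \<subseteq> {1..length R} \<times> {1..length C}"
    using rows columns unfolding P_def by fastforce
  then have "nat_line_sums R C P"
    using assms unfolding nat_line_sums_def has_line_sums_def F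
    by (simp add: row_sum_int_cells column_sum_int_cells)
  then show ?thesis using that F by blast
qed

lemma sym_diff_int_cells: "card (sym_diff (int_cells P) (int_cells Q)) = card (sym_diff P Q)"
proof -
  have "sym_diff (int_cells P) (int_cells Q) = int_cells (sym_diff P Q)"
    by (simp add: image_Un image_set_diff[OF inj_map_prod_int])
  then show ?thesis by (simp add: card_image inj_on_subset[OF inj_map_prod_int])
qed

lemma superposition_of_line_sums:
  assumes P: "nat_line_sums R C P" and Q: "nat_line_sums R C Q"
  defines "y \<equiv> \<lambda>i j. of_bool ((i, j) \<in> P) + of_bool ((i, j) \<in> Q)"
  shows "superposition {1..length R} {1..length C} (\<lambda>i. R ! (i - 1)) (\<lambda>j. C ! (j - 1)) y"
  unfolding superposition_def
proof (intro conjI ballI)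
  fix i j
  show "y i j \<in> {0, 1, 2}" by (auto simp: y_def)
next
  fix i assume i: "i \<in> {1..length R}"
  have "(\<Sum>j=1..length C. of_bool ((i, j) \<in> S)) = int (R ! (i - 1))" if "nat_line_sums R C S" for S
  proof -
    have "{x \<in> S. fst x = i} = Pair i ` ({1..length C} \<inter> {j. (i, j) \<in> S})"
      using that by (auto simp: nat_line_sums_def)
    then have "card {x \<in> S. fst x = i} = card ({1..length C} \<inter> {j. (i, j) \<in> S})"
      by (simp add: card_image inj_on_def)
    moreover have "card {x \<in> S. fst x = i} = R ! (i - 1)"
      using that i by (auto simp: nat_line_sums_def)
    ultimately show ?thesis by simp
  qed
  then show "(\<Sum>j=1..length C. y i j) = 2 * int (R ! (i - 1))"
    using P Q by (simp add: y_def sum.distrib)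
next
  fix j assume j: "j \<in> {1..length C}"
  have "(\<Sum>i=1..length R. of_bool ((i, j) \<in> S)) = int (C ! (j - 1))" if "nat_line_sums R C S" for S
  proof -
    have "{x \<in> S. snd x = j} = (\<lambda>i. (i, j)) ` ({1..length R} \<inter> {i. (i, j) \<in> S})"
      using that by (auto simp: nat_line_sums_def)
    then have "card {x \<in> S. snd x = j} = card ({1..length R} \<inter> {i. (i, j) \<in> S})"
      by (simp add: card_image inj_on_def)
    moreover have "card {x \<in> S. snd x = j} = C ! (j - 1)"
      using that j by (auto simp: nat_line_sums_def)
    ultimately show ?thesis by simp
  qed
  then show "(\<Sum>i=1..length R. y i j) = 2 * int (C ! (j - 1))"
    using P Q by (simp add: y_def sum.distrib)
qed

lemma row_entry_le:
  assumes "nat_line_sums R C P" and "i \<in> {1..length R}"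
  shows "R ! (i - 1) \<le> length C"
proof -
  have "{x \<in> P. fst x = i} \<subseteq> Pair i ` {1..length C}"
    using assms by (auto simp: nat_line_sums_def)
  then have "card {x \<in> P. fst x = i} \<le> card (Pair i ` {1..length C})"
    by (intro card_mono) auto
  also have "\<dots> = length C" by (simp add: card_image inj_on_def)
  finally show ?thesis using assms by (simp add: nat_line_sums_def)
qed

section \<open>The lower bound\<close>

lemma large_symmetric_difference:
  assumes C: "non_increasing C" and cons: "consistent R C" and nuniq: "\<not> uniquely_determine R C"
  shows "\<exists>F2 F3. has_line_sums R C F2 \<and> has_line_sums R C F3 \<and>
    real (card (sym_diff F2 F3)) \<ge> 2 * alpha R C + 2"
proof -
  define I J where "I = {1..length R}" and "J = {1..length C}"
  define r where "r i = R ! (i - 1)" for i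
  define c where "c j = C ! (j - 1)" for j
  obtain F F' where F: "has_line_sums R C F" "has_line_sums R C F'" "F \<noteq> F'"
    using cons nuniq by (auto simp: consistent_def uniquely_determine_def)
  obtain P where P: "nat_line_sums R C P" "F = int_cells P" by (rule has_line_sumsE[OF F(1)])
  obtain Q where Q: "nat_line_sums R C Q" "F' = int_cells Q" by (rule has_line_sumsE[OF F(2)])
  define y0 :: "nat \<Rightarrow> nat \<Rightarrow> int" where "y0 i j = of_bool ((i, j) \<in> P) + of_bool ((i, j) \<in> Q)" for i j
  have y0: "superposition I J r c y0"
    using superposition_of_line_sums[OF P(1) Q(1)]
    by (simp add: I_def J_def r_def[abs_def] c_def[abs_def] y0_def[abs_def])
  obtain y where y: "superposition I J r c y" and ge: "single_cells I J y0 \<le> single_cells I J y"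
    and max: "\<And>y'. superposition I J r c y' \<Longrightarrow> single_cells I J y' \<le> single_cells I J y"
    using maximal_superposition_exists[OF _ _ y0] by (auto simp: I_def J_def)
  \<comment> \<open>Two different sets leave some cell covered once, so \<open>y0\<close>, and with
    it the maximal \<open>y\<close>, has a positive number of single cells, as strictness
    requires.\<close>
  have "P \<noteq> Q" using F P Q by blast
  then obtain i j where "(i, j) \<in> sym_diff P Q" by auto
  then have ij: "i \<in> I" "j \<in> J" "y0 i j = 1"
    using P Q by (auto simp: nat_line_sums_def I_def J_def y0_def)
  have nonneg: "0 \<le> y0 i j * (2 - y0 i j)" for i j by (simp add: y0_def)
  have "y0 i j * (2 - y0 i j) \<le> (\<Sum>j\<in>J. y0 i j * (2 - y0 i j))"
    by (rule member_le_sum[OF ij(2)]) (auto intro: nonneg simp: J_def simp del: mult_nonneg_nonneg)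
  then have "1 \<le> (\<Sum>j\<in>J. y0 i j * (2 - y0 i j))" using ij(3) by simp
  also have "\<dots> \<le> single_cells I J y0"
    unfolding single_cells_def
    by (rule member_le_sum[OF ij(1)]) (auto intro!: sum_nonneg nonneg simp: I_def)
  finally have pos: "0 < single_cells I J y" using ge by simp
  have c_mono: "c b \<le> c a" if "1 \<le> a" "a < b" "b \<le> length C" for a b
    using C that by (auto simp: non_increasing_def c_def sorted_wrt_iff_nth_less)
  have rn: "r i \<le> length C" if "i \<in> I" for i
    using row_entry_le[OF P(1)] that by (simp add: I_def r_def)
  let ?d = "\<Sum>j=1..length C. \<bar>int (c j) - int (card {i \<in> I. j \<le> r i})\<bar>"
  have finI: "finite I" by (simp add: I_def)
  note yJ = y[unfolded J_def]
  have "?d < single_cells I J y"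
    using maximal_superposition_gt[OF finI yJ max[unfolded J_def] pos[unfolded J_def] c_mono rn]
    by (simp add: J_def)
  moreover have "even ?d" by (rule column_deviation_even[OF finI yJ rn])
  moreover have "even (single_cells I J y)" by (rule single_cells_even[OF y])
  \<comment> \<open>Both sides are even, so the strict inequality improves to a gap of 2. This is
    the \<open>+ 2\<close> of the bound, since \<open>?d\<close> is twice \<alpha>.\<close>
  ultimately have gap: "?d + 2 \<le> single_cells I J y" by presburger
  have alpha: "2 * alpha R C = of_int ?d"
    by (simp add: alpha_def v_seq_def c_def r_def I_def)
  obtain P' Q' where "P' \<subseteq> I \<times> J" "Q' \<subseteq> I \<times> J"
    "\<And>i. i \<in> I \<Longrightarrow> card {x \<in> P'. fst x = i} = r i" "\<And>i. i \<in> I \<Longrightarrow> card {x \<in> Q'. fst x = i} = r i"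
    "\<And>j. j \<in> J \<Longrightarrow> card {x \<in> P'. snd x = j} = c j" "\<And>j. j \<in> J \<Longrightarrow> card {x \<in> Q'. snd x = j} = c j"
    and card: "int (card (sym_diff P' Q')) = single_cells I J y"
    using superposition_split[OF _ _ y] by (auto simp: I_def J_def)
  then have "nat_line_sums R C P'" "nat_line_sums R C Q'"
    by (simp_all add: nat_line_sums_def I_def J_def r_def c_def)
  then have "has_line_sums R C (int_cells P')" "has_line_sums R C (int_cells Q')"
    by (simp_all add: has_line_sums_int_cells)
  moreover have "real (card (sym_diff (int_cells P') (int_cells Q'))) \<ge> 2 * alpha R C + 2"
  proof -
    have "of_int (?d + 2) \<le> (of_int (int (card (sym_diff P' Q'))) :: real)"
      using gap card by (simp only: of_int_le_iff)
    then show ?thesis unfolding sym_diff_int_cells alpha by simp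
  qed
  ultimately show ?thesis by blast
qed

section \<open>Sharpness\<close>

lemma card_nat_line_sums:
  assumes "nat_line_sums R C P"
  shows "card P = (\<Sum>i=1..length R. R ! (i - 1))"
proof -
  have sub: "P \<subseteq> {1..length R} \<times> {1..length C}" using assms by (simp add: nat_line_sums_def)
  then have fin: "finite P" by (auto intro: finite_subset)
  have "(\<Union>i\<in>{1..length R}. {x \<in> P. fst x = i}) = P" using sub by fastforce
  then have "card P = card (\<Union>i\<in>{1..length R}. {x \<in> P. fst x = i})" by simp
  also have "\<dots> = (\<Sum>i=1..length R. card {x \<in> P. fst x = i})"
    by (rule card_UN_disjoint) (use fin in auto)
  finally show ?thesis using assms by (simp add: nat_line_sums_def)
qed

lemma permutation_line_sums:
  assumes p: "bij_betw p {1..k} {1..k}"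
  shows "nat_line_sums (replicate k 1) (replicate k 1) ((\<lambda>i. (i, p i)) ` {1..k})"
  unfolding nat_line_sums_def
proof (intro conjI ballI)
  let ?P = "(\<lambda>i. (i, p i)) ` {1..k}"
  show "?P \<subseteq> {1..length (replicate k (1::nat))} \<times> {1..length (replicate k (1::nat))}"
    using bij_betwE[OF p] by auto
  show "card {x \<in> ?P. fst x = i} = replicate k 1 ! (i - 1)" if "i \<in> {1..length (replicate k (1::nat))}" for i
  proof -
    have "{x \<in> ?P. fst x = i} = {(i, p i)}" using that by auto
    moreover have "replicate k (1::nat) ! (i - 1) = 1" using that by (intro nth_replicate) auto
    ultimately show ?thesis by simp
  qed
  show "card {x \<in> ?P. snd x = j} = replicate k 1 ! (j - 1)" if "j \<in> {1..length (replicate k (1::nat))}" for j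
  proof -
    have "j \<in> p ` {1..k}" using p that by (auto simp: bij_betw_def)
    then obtain i where i: "i \<in> {1..k}" "p i = j" by auto
    have "{x \<in> ?P. snd x = j} = (\<lambda>i. (i, p i)) ` {l \<in> {1..k}. p l = j}" by auto
    also have "{l \<in> {1..k}. p l = j} = {i}"
    proof (intro equalityI subsetI)
      fix l assume "l \<in> {l \<in> {1..k}. p l = j}"
      then have "l \<in> {1..k}" "p l = p i" using i by simp_all
      with i(1) have "l = i" using bij_betw_imp_inj_on[OF p] by (metis inj_onD)
      then show "l \<in> {i}" by simp
    next
      fix l assume "l \<in> {i}"
      then show "l \<in> {l \<in> {1..k}. p l = j}" using i by simp
    qed
    finally have "{x \<in> ?P. snd x = j} = {(i, p i)}" by simp
    moreover have "replicate k (1::nat) ! (j - 1) = 1" using that by (intro nth_replicate) auto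
    ultimately show ?thesis by simp
  qed
qed

text \<open>The left-justified matrix is a full first column. Column 1 deviates by
  \<open>k - 1\<close> and each of the other \<open>k - 1\<close> columns by 1; half of the total is
  \<open>k - 1\<close>.\<close>

lemma alpha_replicate_one:
  assumes "k \<ge> 1"
  shows "alpha (replicate k 1) (replicate k 1) = real k - 1"
proof -
  have entry: "replicate k (1::nat) ! (l - 1) = 1" if "l \<in> {1..k}" for l
    using that by (intro nth_replicate) auto
  have v: "v_seq (replicate k 1) j = (if j = 1 then k else 0)" if "j \<in> {1..k}" for j
  proof -
    have "{l \<in> {1..k}. j \<le> replicate k (1::nat) ! (l - 1)} = (if j = 1 then {1..k} else {})"
      using that entry by auto
    then show ?thesis by (simp add: v_seq_def)
  qed
  have "(\<Sum>j=1..k. \<bar>real (replicate k (1::nat) ! (j - 1)) - real (v_seq (replicate k 1) j)\<bar>)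
      = (\<Sum>j=1..k. if j = 1 then real k - 1 else 1)"
    by (rule sum.cong[OF refl]) (use v entry assms in auto)
  also have "\<dots> = (real k - 1) + (\<Sum>j\<in>{1..k} - {1}. 1)"
    using assms by (subst sum.remove[of _ 1]) auto
  also have "\<dots> = 2 * (real k - 1)" using assms by (simp add: of_nat_diff)
  finally show ?thesis by (simp add: alpha_def)
qed

text \<open>Every set with these line sums has exactly \<open>k\<close> cells, so two of them differ
  in at most \<open>2 * k\<close> cells.\<close>

lemma permutation_matrices_sharp:
  assumes "k \<ge> 2"
  defines "R \<equiv> replicate k 1"
  shows "non_increasing R" and "consistent R R" and "\<not> uniquely_determine R R"
    and "has_line_sums R R F2 \<Longrightarrow> has_line_sums R R F3 \<Longrightarrow> card (sym_diff F2 F3) \<le> 2 * k"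
proof -
  \<comment> \<open>The diagonal and the antidiagonal: for \<open>k \<ge> 2\<close> the corner
    \<open>(1, 1)\<close> lies only on the first, which refutes uniqueness.\<close>
  let ?A = "int_cells ((\<lambda>i. (i, id i)) ` {1..k})"
  let ?B = "int_cells ((\<lambda>i. (i, Suc k - i)) ` {1..k})"
  have "bij_betw (\<lambda>i. Suc k - i) {1..k} {1..k}"
    by (rule bij_betw_byWitness[where f' = "\<lambda>i. Suc k - i"]) auto
  then have AB: "has_line_sums R R ?A" "has_line_sums R R ?B"
    unfolding R_def by (intro has_line_sums_int_cells permutation_line_sums bij_betw_id; assumption)+
  show "non_increasing R" by (simp add: R_def non_increasing_def sorted_wrt_iff_nth_less)
  show "consistent R R" using AB by (auto simp: consistent_def)
  have "(1, 1) \<in> ?A" using assms(1) by (auto intro!: image_eqI[of _ _ "(1, 1)"])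
  moreover have "(1, 1) \<notin> ?B" using assms(1) by auto
  ultimately have "?A \<noteq> ?B" by metis
  then show "\<not> uniquely_determine R R"
    using AB unfolding uniquely_determine_def by metis
  show "card (sym_diff F2 F3) \<le> 2 * k" if "has_line_sums R R F2" "has_line_sums R R F3"
  proof -
    have card: "card F = k" if F: "has_line_sums R R F" for F
    proof -
      obtain P where P: "nat_line_sums R R P" "F = int_cells P" by (rule has_line_sumsE[OF F])
      have "card P = (\<Sum>i=1..k. R ! (i - 1))" using card_nat_line_sums[OF P(1)] by (simp add: R_def)
      also have "\<dots> = (\<Sum>i=1..k. 1)"
      proof (rule sum.cong[OF refl])
        fix i assume "i \<in> {1..k}"
        then show "R ! (i - 1) = 1" unfolding R_def by (intro nth_replicate) auto
      qed
      finally show ?thesis using P(2) by (simp add: card_image inj_on_subset[OF inj_map_prod_int])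
    qed
    have fin: "finite F2" "finite F3" using that by (auto simp: has_line_sums_def)
    have "card (sym_diff F2 F3) \<le> card (F2 \<union> F3)" by (rule card_mono) (use fin in auto)
    also have "\<dots> \<le> card F2 + card F3" by (rule card_Un_le)
    finally show ?thesis using that by (simp add: card)
  qed
qed

theorem theorem1:
  shows "(\<forall>R C. non_increasing R \<and> non_increasing C \<and>
            consistent R C \<and> \<not> uniquely_determine R C \<longrightarrow>
            (\<exists>F2 F3. has_line_sums R C F2 \<and> has_line_sums R C F3 \<and>
               real (card (sym_diff F2 F3)) \<ge> 2 * alpha R C + 2)) \<and>
         (\<forall>a::int. a \<ge> 1 \<longrightarrow>
            (\<exists>R C. non_increasing R \<and> non_increasing C \<and>
               consistent R C \<and> \<not> uniquely_determine R C \<and>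
               alpha R C = real_of_int a \<and>
               (\<forall>F2 F3. has_line_sums R C F2 \<and> has_line_sums R C F3 \<longrightarrow>
                  int (card (sym_diff F2 F3)) \<le> 2 * a + 2)))"
proof (intro conjI allI impI)
  fix R C
  assume "non_increasing R \<and> non_increasing C \<and> consistent R C \<and> \<not> uniquely_determine R C"
  then show "\<exists>F2 F3. has_line_sums R C F2 \<and> has_line_sums R C F3 \<and>
      real (card (sym_diff F2 F3)) \<ge> 2 * alpha R C + 2"
    using large_symmetric_difference by blast
next
  fix a :: int assume a: "a \<ge> 1"
  \<comment> \<open>This size makes \<alpha> equal to \<open>k - 1 = a\<close> and turns the bound
    \<open>2 * k\<close> into \<open>2 * a + 2\<close>.\<close>
  define k where "k = nat (a + 1)"
  have k: "k \<ge> 2" "int k = a + 1" using a by (auto simp: k_def)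
  let ?R = "replicate k (1::nat)"
  have "alpha ?R ?R = real_of_int a"
  proof -
    have "real k = real_of_int a + 1" using k(2) by (metis of_int_1 of_int_add of_int_of_nat_eq)
    then show ?thesis using alpha_replicate_one[of k] k(1) by simp
  qed
  moreover have "int (card (sym_diff F2 F3)) \<le> 2 * a + 2"
    if "has_line_sums ?R ?R F2" "has_line_sums ?R ?R F3" for F2 F3
    using permutation_matrices_sharp(4)[OF k(1) that] k(2) by linarith
  ultimately show "\<exists>R C. non_increasing R \<and> non_increasing C \<and>
      consistent R C \<and> \<not> uniquely_determine R C \<and> alpha R C = real_of_int a \<and>
      (\<forall>F2 F3. has_line_sums R C F2 \<and> has_line_sums R C F3 \<longrightarrow>
        int (card (sym_diff F2 F3)) \<le> 2 * a + 2)"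
    using permutation_matrices_sharp(1-3)[OF k(1)] by blast
qed

end
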